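(* Let $R$ be a ring with nonzero multiplication, i.e. there exist $\alpha,\beta\in R$ with $\alpha\beta\neq 0$. Then the restricted direct power $R^{(\infty)}$ is not $\mathbf{q}_\omega$-compact (in the language $\mathcal{L}_r(R^{(\infty)})$).
   Context: $R^\infty=\prod_{i=1}^\infty R$ is the ring of all sequences $(r_1,r_2,\dots)$ with $r_i\in R$ and componentwise operations; $R^{(\infty)}$ is its subring of all sequences with only finitely many indices $i$ such that $r_i\neq 0$. $\mathcal{L}_r=\{+,-,\cdot,0\}$ is the language of rings (rings are not assumed to be unital or commutative), and for a ring $H$, $\mathcal{L}_r(H)$ is $\mathcal{L}_r$ extended by a constant symbol for every element of $H$ (interpreted as that element). An $\mathcal{L}_r(H)$-equation is an equality $p(X)=q(X)$ of two terms of $\mathcal{L}_r(H)$. A system is an arbitrary set of equations in a finite set of variables $X=\{x_1,\dots,x_n\}$; $\mathrm{V}_H(\mathbf{S})\subseteq H^n$ denotes its set of solutions in $H$. A ring $H$ is $\mathbf{q}_\omega$-compact if for every infinite system $\mathbf{S}$ of $\mathcal{L}_r(H)$-equations (in finitely many variables $X$) and every $\mathcal{L}_r(H)$-equation $p(X)=q(X)$ with $\mathrm{V}_H(\mathbf{S})\subseteq \mathrm{V}_H(p(X)=q(X))$ there is a finite subsystem $\mathbf{S}'\subseteq\mathbf{S}$ with $\mathrm{V}_H(\mathbf{S}')\subseteq \mathrm{V}_H(p(X)=q(X))$. *)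

theory Defs
  imports Main "HOL-Library.FuncSet"
begin

text \<open>
  A ring (not necessarily unital or commutative) is a type of class \<open>ring\<close>.
  In the language \<open>{+, -, \<cdot>, 0}\<close> the symbol \<open>-\<close> is taken to be unary. The
  type \<open>(nat, 'h) ring_term\<close> consists of the terms of this language extended by
  a constant symbol for each element of \<open>'h\<close>; the variable \<open>x\<^sub>i\<close> of the usual
  numbering is \<open>Var (i - 1)\<close>.
\<close>

datatype (vars: 'v, 'h) ring_term =
    Var 'v
  | Const 'h
  | Zero
  | Neg "('v, 'h) ring_term"
  | Add "('v, 'h) ring_term" "('v, 'h) ring_term"
  | Mult "('v, 'h) ring_term" "('v, 'h) ring_term"

primrec eval :: "('v \<Rightarrow> 'h::ring) \<Rightarrow> ('v, 'h) ring_term \<Rightarrow> 'h" where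
  "eval x (Var i) = x i"
| "eval x (Const c) = c"
| "eval x Zero = 0"
| "eval x (Neg s) = - eval x s"
| "eval x (Add s t) = eval x s + eval x t"
| "eval x (Mult s t) = eval x s * eval x t"

text \<open>The pair \<open>(p, q)\<close> stands for the equation \<open>p = q\<close>.\<close>

type_synonym 'h equation = "(nat, 'h) ring_term \<times> (nat, 'h) ring_term"

definition equations :: "nat \<Rightarrow> 'h equation set" where
  "equations n = {(p, q). vars p \<subseteq> {..<n} \<and> vars q \<subseteq> {..<n}}"

text \<open>Points of \<open>H\<^sup>n\<close> are extensional functions on \<open>{..<n}\<close>.\<close>

definition solutions :: "nat \<Rightarrow> 'h::ring equation set \<Rightarrow> (nat \<Rightarrow> 'h) set" where
  "solutions n S = {x \<in> {..<n} \<rightarrow>\<^sub>E UNIV. \<forall>(p, q) \<in> S. eval x p = eval x q}"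

definition q_omega_compact :: "'h::ring itself \<Rightarrow> bool" where
  "q_omega_compact _ \<longleftrightarrow>
    (\<forall>n. \<forall>S \<subseteq> (equations n :: 'h equation set). \<forall>e \<in> equations n.
      infinite S \<longrightarrow> solutions n S \<subseteq> solutions n {e} \<longrightarrow>
        (\<exists>S' \<subseteq> S. finite S' \<and> solutions n S' \<subseteq> solutions n {e}))"

text \<open>
  The restricted direct power \<open>R\<^sup>(\<^sup>\<infinity>\<^sup>)\<close>: finitely supported sequences with
  componentwise operations. The index set \<open>{1, 2, \<dots>}\<close> is represented by \<open>nat\<close>.
  The library type of finitely supported maps is not used since its
  multiplication is convolution.
\<close>

typedef (overloaded) 'r restricted_power =
  "{r :: nat \<Rightarrow> 'r::zero. finite {i. r i \<noteq> 0}}"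
  morphisms component Abs_restricted_power
  by (rule exI [of _ "\<lambda>_. 0"]) simp

setup_lifting type_definition_restricted_power

instantiation restricted_power :: (ring) ring
begin

lift_definition zero_restricted_power :: "'a restricted_power" is "\<lambda>_. 0"
  by simp

lift_definition plus_restricted_power ::
  "'a restricted_power \<Rightarrow> 'a restricted_power \<Rightarrow> 'a restricted_power"
  is "\<lambda>r s i. r i + s i"
proof -
  fix r s :: "nat \<Rightarrow> 'a"
  assume "finite {i. r i \<noteq> 0}" "finite {i. s i \<noteq> 0}"
  then have "finite ({i. r i \<noteq> 0} \<union> {i. s i \<noteq> 0})" by simp
  then show "finite {i. r i + s i \<noteq> 0}" by (rule rev_finite_subset) auto
qed

lift_definition uminus_restricted_power ::
  "'a restricted_power \<Rightarrow> 'a restricted_power"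
  is "\<lambda>r i. - r i"
  by simp

lift_definition minus_restricted_power ::
  "'a restricted_power \<Rightarrow> 'a restricted_power \<Rightarrow> 'a restricted_power"
  is "\<lambda>r s i. r i - s i"
proof -
  fix r s :: "nat \<Rightarrow> 'a"
  assume "finite {i. r i \<noteq> 0}" "finite {i. s i \<noteq> 0}"
  then have "finite ({i. r i \<noteq> 0} \<union> {i. s i \<noteq> 0})" by simp
  then show "finite {i. r i - s i \<noteq> 0}" by (rule rev_finite_subset) auto
qed

lift_definition times_restricted_power ::
  "'a restricted_power \<Rightarrow> 'a restricted_power \<Rightarrow> 'a restricted_power"
  is "\<lambda>r s i. r i * s i"
proof -
  fix r s :: "nat \<Rightarrow> 'a"
  assume "finite {i. r i \<noteq> 0}"
  then show "finite {i. r i * s i \<noteq> 0}" by (rule rev_finite_subset) auto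
qed

instance
  by standard (transfer; simp add: fun_eq_iff algebra_simps)+

end

end

theory Submission
  imports Defs
begin

text \<open>
  Write \<open>\<beta>\<^sub>i\<close> for the sequence with \<open>\<beta>\<close> in place \<open>i\<close> and \<open>0\<close> elsewhere. In one variable, the
  equation \<open>x \<cdot> \<beta>\<^sub>i = (\<alpha>\<beta>)\<^sub>i\<close> only constrains the coordinate \<open>i\<close> of \<open>x\<close>: it reads
  \<open>x\<^sub>i \<beta> = \<alpha>\<beta>\<close>, which \<open>x\<^sub>i = \<alpha>\<close> satisfies and, as \<open>\<alpha>\<beta> \<noteq> 0\<close>, \<open>x\<^sub>i = 0\<close> does not. Hence finitely
  many of these equations have a common solution, whereas a solution of all of them would have
  infinite support. So the whole system is inconsistent and entails even a false equation between
  constants, such as \<open>(\<alpha>\<beta>)\<^sub>0 = 0\<close>, which no finite subsystem entails.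
\<close>

lift_definition single :: "nat \<Rightarrow> 'r::zero \<Rightarrow> 'r restricted_power"
  is "\<lambda>i r j. if j = i then r else 0"
  by simp

lemma single_eq_zero_iff [simp]: "single i r = 0 \<longleftrightarrow> r = (0 :: 'r::ring)"
  by transfer (auto simp: fun_eq_iff)

lemma single_inject_index:
  assumes "r \<noteq> 0" "single i r = single j r"
  shows "i = j"
  using assms by transfer (metis (full_types))

lemma mult_single_eq_single_iff:
  fixes x :: "'r::ring restricted_power"
  shows "x * single i r = single i s \<longleftrightarrow> component x i * r = s"
  by transfer (auto simp: fun_eq_iff)

lemma finite_support: "finite {i. component x i \<noteq> 0}"
  using component [of x] by simp

lemma ex_component_eq_on_finite:
  fixes r :: "'r::zero"
  assumes "finite I"
  shows "\<exists>x. \<forall>i \<in> I. component x i = r"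
proof -
  have "finite {i. (if i \<in> I then r else 0) \<noteq> 0}"
    using assms by (rule rev_finite_subset) auto
  then have "component (Abs_restricted_power (\<lambda>i. if i \<in> I then r else 0)) =
      (\<lambda>i. if i \<in> I then r else 0)"
    by (simp add: Abs_restricted_power_inverse)
  then show ?thesis
    by (metis (no_types, lifting))
qed

theorem theorem3p4:
  assumes "\<exists>\<alpha> \<beta> :: 'r::ring. \<alpha> * \<beta> \<noteq> 0"
  shows "\<not> q_omega_compact TYPE('r restricted_power)"
proof
  assume compact: "q_omega_compact TYPE('r restricted_power)"
  obtain \<alpha> \<beta> :: 'r where nz: "\<alpha> * \<beta> \<noteq> 0"
    using assms by blast
  define eqn :: "nat \<Rightarrow> 'r restricted_power equation" where
    "eqn i = (Mult (Var 0) (Const (single i \<beta>)), Const (single i (\<alpha> * \<beta>)))" for i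
  define e :: "'r restricted_power equation" where
    "e = (Const (single 0 (\<alpha> * \<beta>)), Zero)"
  have solutions_eqn: "x \<in> solutions 1 (eqn ` I) \<longleftrightarrow>
      x \<in> {..<1} \<rightarrow>\<^sub>E UNIV \<and> (\<forall>i \<in> I. component (x 0) i * \<beta> = \<alpha> * \<beta>)" for x I
    by (auto simp: solutions_def eqn_def mult_single_eq_single_iff)
  have no_solution_e: "solutions 1 {e} = {}"
    using nz by (simp add: solutions_def e_def)
  have "inj eqn"
    using single_inject_index [OF nz] by (auto simp: inj_def eqn_def)
  then have "infinite (range eqn)"
    by (simp add: finite_image_iff)
  moreover have "range eqn \<subseteq> equations 1" "e \<in> equations 1"
    by (auto simp: equations_def eqn_def e_def)
  moreover have "solutions 1 (range eqn) = {}"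
  proof -
    have False if "\<forall>i. component (x 0) i * \<beta> = \<alpha> * \<beta>" for x :: "nat \<Rightarrow> 'r restricted_power"
    proof -
      have "component (x 0) i \<noteq> 0" for i
        using that nz by (metis mult_zero_left)
      then show False
        using finite_support [of "x 0"] by simp
    qed
    then show ?thesis
      unfolding set_eq_iff solutions_eqn by blast
  qed
  ultimately obtain S' where "S' \<subseteq> range eqn" "finite S'" "solutions 1 S' \<subseteq> solutions 1 {e}"
    using compact unfolding q_omega_compact_def by (metis empty_subsetI)
  then obtain I where "finite I" and unsolvable: "solutions 1 (eqn ` I) = {}"
    using no_solution_e by (metis finite_subset_image subset_empty)
  then obtain h where "\<forall>i \<in> I. component h i = \<alpha>"
    using ex_component_eq_on_finite by blast
  then have "(\<lambda>j \<in> {..<1}. h) \<in> solutions 1 (eqn ` I)"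
    unfolding solutions_eqn by simp
  with unsolvable show False
    by simp
qed

end
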